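(* For all $p,q\in\mathbb{N}_0$ and $n\in\mathbb{N}_0$, \[ \sum_{k=0}^n\binom{p+k}{p}\binom{q+n-k}{q}H_{p+k}H_{q+n-k} =\binom{p+q+n+1}{n}\Big\{\big(H_{p+q+1}^{\langle 2\rangle}-H_{p+q+n+1}^{\langle 2\rangle}\big)+\big(H_p-H_{p+q+1}+H_{p+q+n+1}\big)\big(H_q-H_{p+q+1}+H_{p+q+n+1}\big)\Big\}. \]
   Context: $\mathbb{N}_0$ denotes the set of nonnegative integers and $\mathbb{N}$ the set of positive integers. For $l\in\mathbb{N}$ the generalized harmonic numbers are $H_0^{\langle l\rangle}=0$ and $H_n^{\langle l\rangle}=\sum_{k=1}^n\frac{1}{k^l}$ for $n\ge 1$. The classical harmonic numbers are $H_n=H_n^{\langle 1\rangle}$, so $H_0=0$ and $H_n=\sum_{k=1}^n\frac1k$. *)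

theory Defs
  imports "HOL-Analysis.Harmonic_Numbers"
begin

text \<open>Only orders \<open>l \<ge> 1\<close> are intended; the empty sum gives the value 0 at \<open>n = 0\<close>.\<close>

definition gen_harm :: "nat \<Rightarrow> nat \<Rightarrow> real" where
  "gen_harm l n = (\<Sum>k=1..n. 1 / real k ^ l)"

text \<open>The classical harmonic numbers are the library's \<^const>\<open>harm\<close>.\<close>

lemma gen_harm_1: "gen_harm 1 n = harm n"
  by (simp add: gen_harm_def harm_def inverse_eq_divide)

end

theory Submission
  imports Defs
begin

text \<open>
  The identity is a mixed second derivative of the Chu--Vandermonde convolution
  \[ \sum_{k\le n} \binom nk (a)_k (b)_{n-k} = (a+b)_n \]
  for rising factorials \<open>(a)\<^sub>k = a (a+1) \<dots> (a+k-1)\<close>. For \<open>a > 0\<close> the logarithmic derivative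
  of \<open>(a)\<^sub>k\<close> is \<open>\<Sum>i<k. 1/(a+i)\<close>; at \<open>a = p + 1\<close> this is \<open>H\<^sub>p\<^sub>+\<^sub>k - H\<^sub>p\<close>, while
  \<open>(p+1)\<^sub>k / k!\<close> is the binomial coefficient \<open>p + k\<close> over \<open>p\<close>. So differentiation by \<open>a\<close>
  inserts a weight \<open>H\<^sub>p\<^sub>+\<^sub>k - H\<^sub>p\<close> into the convolution, and differentiation by \<open>b\<close> inserts
  \<open>H\<^sub>q\<^sub>+\<^sub>n\<^sub>-\<^sub>k - H\<^sub>q\<close>. The right-hand side depends on \<open>a + b\<close> only, so the mixed derivative there
  is the ordinary second derivative of \<open>(s)\<^sub>n\<close> at \<open>s = p + q + 2\<close>, namely
  \<open>(s)\<^sub>n (L\<^sup>2 + L')\<close> with \<open>L\<close> the logarithmic derivative; the term \<open>L'\<close> is where the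
  harmonic numbers of order two come from.

  Finally
  \[ H_{p+k} H_{q+n-k} = (H_{p+k}-H_p)(H_{q+n-k}-H_q) + H_q (H_{p+k}-H_p) + H_p (H_{q+n-k}-H_q)
      + H_p H_q \]
  reduces the claim to the convolution with both weights (\<open>vandermonde_weighted_both\<close>), with either
  one (\<open>vandermonde_weighted_left\<close>, \<open>vandermonde_weighted_right\<close>), and with none.
\<close>

text \<open>
  Order 1 is the logarithmic derivative of \<open>pochhammer a n\<close> and order 2 is minus the derivative
  of order 1; at \<open>a = p + 1\<close> the sum is a difference of two generalized harmonic numbers.
\<close>

definition recip_sum :: "nat \<Rightarrow> real \<Rightarrow> nat \<Rightarrow> real" where
  "recip_sum l a n = (\<Sum>i<n. 1 / (a + real i) ^ l)"

lemma pochhammer_has_derivative: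
  assumes "a > 0"
  shows "((\<lambda>x. pochhammer x n) has_real_derivative pochhammer a n * recip_sum 1 a n) (at a)"
proof (induction n)
  case 0
  then show ?case by (simp add: recip_sum_def)
next
  case (Suc n)
  have "a + real n \<noteq> 0" using assms by linarith
  then show ?case
    unfolding pochhammer_Suc
    by (auto intro!: derivative_eq_intros Suc.IH simp: recip_sum_def field_simps)
qed

lemma recip_sum_has_derivative:
  assumes "a > 0"
  shows "((\<lambda>x. recip_sum 1 x n) has_real_derivative - recip_sum 2 a n) (at a)"
proof -
  have "a + real i \<noteq> 0" for i using assms by linarith
  then show ?thesis
    unfolding recip_sum_def
    by (auto intro!: derivative_eq_intros simp: sum_negf[symmetric] power2_eq_square)
qed

lemma pochhammer_add_has_derivative:
  assumes "a > 0" "b > 0"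
  shows "((\<lambda>x. pochhammer (a + x) n) has_real_derivative
            pochhammer (a + b) n * recip_sum 1 (a + b) n) (at b)"
  using DERIV_shift[of "\<lambda>x. pochhammer x n" _ b a] pochhammer_has_derivative[of "a + b" n] assms
  by (simp add: add.commute)

lemma recip_sum_add_has_derivative:
  assumes "a > 0" "b > 0"
  shows "((\<lambda>x. recip_sum 1 (a + x) n) has_real_derivative - recip_sum 2 (a + b) n) (at b)"
  using DERIV_shift[of "\<lambda>x. recip_sum 1 x n" _ b a] recip_sum_has_derivative[of "a + b" n] assms
  by (simp add: add.commute)

text \<open>
  Both expressions are the derivative by \<open>b\<close> of \<open>pochhammer (a + b) n\<close>: one after expanding it by
  the Chu--Vandermonde convolution, the other computed directly.
\<close>

lemma vandermonde_weighted_right: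
  assumes "a > 0" "b > 0"
  shows "(\<Sum>k\<le>n. real (n choose k) * pochhammer a k * (pochhammer b (n - k) * recip_sum 1 b (n - k)))
       = pochhammer (a + b) n * recip_sum 1 (a + b) n"
proof (rule DERIV_unique)
  show "((\<lambda>x. pochhammer (a + x) n) has_real_derivative
     (\<Sum>k\<le>n. real (n choose k) * pochhammer a k * (pochhammer b (n - k) * recip_sum 1 b (n - k)))) (at b)"
    unfolding pochhammer_binomial_sum
    by (intro DERIV_sum DERIV_cmult pochhammer_has_derivative assms)
qed (rule pochhammer_add_has_derivative[OF assms])

text \<open>
  Reversing the order of summation exchanges the roles of \<open>a\<close> and \<open>b\<close>.
\<close>

lemma vandermonde_weighted_left:
  assumes "a > 0" "b > 0"
  shows "(\<Sum>k\<le>n. real (n choose k) * (pochhammer a k * recip_sum 1 a k) * pochhammer b (n - k))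
       = pochhammer (a + b) n * recip_sum 1 (a + b) n"
proof -
  have "(\<Sum>k\<le>n. real (n choose k) * (pochhammer a k * recip_sum 1 a k) * pochhammer b (n - k))
      = (\<Sum>k\<le>n. real (n choose (n - k)) * (pochhammer a (n - k) * recip_sum 1 a (n - k))
            * pochhammer b (n - (n - k)))"
    by (rule sum.nat_diff_reindex[of _ "Suc n", unfolded lessThan_Suc_atMost, simplified, symmetric])
  also have "\<dots> = (\<Sum>k\<le>n. real (n choose k) * pochhammer b k
                      * (pochhammer a (n - k) * recip_sum 1 a (n - k)))"
    by (intro sum.cong) (auto simp: binomial_symmetric[symmetric])
  also have "\<dots> = pochhammer (a + b) n * recip_sum 1 (a + b) n"
    using vandermonde_weighted_right[of b a n] assms by (simp add: add.commute)
  finally show ?thesis .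
qed

text \<open>
  The identity with the left weight holds for every \<open>b > 0\<close>, so both of its sides
  may be differentiated by \<open>b\<close>.
\<close>

lemma vandermonde_weighted_both:
  assumes "a > 0" "b > 0"
  shows "(\<Sum>k\<le>n. real (n choose k) * (pochhammer a k * recip_sum 1 a k)
                    * (pochhammer b (n - k) * recip_sum 1 b (n - k)))
       = pochhammer (a + b) n * ((recip_sum 1 (a + b) n)\<^sup>2 - recip_sum 2 (a + b) n)"
proof (rule DERIV_unique)
  let ?F = "\<lambda>x. \<Sum>k\<le>n. real (n choose k) * (pochhammer a k * recip_sum 1 a k) * pochhammer x (n - k)"
  show "(?F has_real_derivative
     (\<Sum>k\<le>n. real (n choose k) * (pochhammer a k * recip_sum 1 a k)
               * (pochhammer b (n - k) * recip_sum 1 b (n - k)))) (at b)"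
    by (intro DERIV_sum DERIV_cmult pochhammer_has_derivative assms)
  have "((\<lambda>x. pochhammer (a + x) n * recip_sum 1 (a + x) n) has_real_derivative
          pochhammer (a + b) n * ((recip_sum 1 (a + b) n)\<^sup>2 - recip_sum 2 (a + b) n)) (at b)"
    by (rule DERIV_cong[OF DERIV_mult[OF pochhammer_add_has_derivative[OF assms]
            recip_sum_add_has_derivative[OF assms]]])
      (simp add: algebra_simps power2_eq_square)
  then show "(?F has_real_derivative
          pochhammer (a + b) n * ((recip_sum 1 (a + b) n)\<^sup>2 - recip_sum 2 (a + b) n)) (at b)"
    by (rule has_field_derivative_transform_within_open[where S = "{0<..}"])
      (use assms vandermonde_weighted_left in auto)
qed

lemma pochhammer_eq_fact_binomial:
  "pochhammer (real p + 1) k = fact k * real ((p + k) choose p)"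
proof -
  have "fact p * pochhammer (real p + 1) k = fact (p + k)"
    using pochhammer_product'[of "1::real" p k] by (simp add: pochhammer_fact add.commute)
  also have "\<dots> = fact p * (fact k * real ((p + k) choose p))"
    by (simp add: binomial_fact)
  finally show ?thesis by simp
qed

lemma recip_sum_eq_gen_harm:
  "recip_sum l (real p + 1) k = gen_harm l (p + k) - gen_harm l p"
  by (induction k) (auto simp: recip_sum_def gen_harm_def add_ac)

lemma recip_sum_eq_harm:
  "recip_sum 1 (real p + 1) k = harm (p + k) - harm p"
  by (simp add: recip_sum_eq_gen_harm gen_harm_1 del: One_nat_def)

text \<open>
  Up to the constant \<open>n!\<close>, the Chu--Vandermonde summand at \<open>a = p + 1\<close>, \<open>b = q + 1\<close> is the product
  of binomial coefficients to be summed.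
\<close>

lemma binomial_pochhammer_product:
  assumes "k \<le> n"
  shows "real (n choose k) * pochhammer (real p + 1) k * pochhammer (real q + 1) (n - k)
       = fact n * (real ((p + k) choose p) * real ((q + n - k) choose q))"
proof -
  have "fact k * fact (n - k) * real (n choose k) = fact n"
    by (simp add: binomial_fact[OF assms])
  then show ?thesis
    using assms by (simp add: pochhammer_eq_fact_binomial) (simp add: mult_ac)
qed

theorem theorem1:
  fixes p q n :: nat
  shows "(\<Sum>k=0..n. real ((p + k) choose p) * real ((q + n - k) choose q)
            * harm (p + k) * harm (q + n - k))
       = real ((p + q + n + 1) choose n) *
         ((gen_harm 2 (p + q + 1) - gen_harm 2 (p + q + n + 1))
          + (harm p - harm (p + q + 1) + harm (p + q + n + 1))
            * (harm q - harm (p + q + 1) + harm (p + q + n + 1)))"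
proof -
  define a b s where params: "a = real p + 1" "b = real q + 1" "s = real (p + q + 1) + 1"
  define C where "C = real ((p + q + n + 1) choose n)"
  have pos: "a > 0" "b > 0" and s: "a + b = s"
    by (simp_all add: params)
  have total: "pochhammer s n = fact n * C"
    using pochhammer_eq_fact_binomial[of "p + q + 1" n] binomial_symmetric[of n "p + q + n + 1"]
    by (simp add: params C_def add_ac)
  define D where "D = (harm (p + q + n + 1) - harm (p + q + 1) :: real)"
  define D2 where "D2 = gen_harm 2 (p + q + n + 1) - gen_harm 2 (p + q + 1)"
  have "p + q + 1 + n = p + q + n + 1"
    by simp
  then have L: "recip_sum 1 s n = D" "recip_sum 2 s n = D2"
    using recip_sum_eq_harm[of "p + q + 1" n] recip_sum_eq_gen_harm[of 2 "p + q + 1" n]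
    unfolding params D_def D2_def by metis+
  define w where "w k = real (n choose k) * pochhammer a k * pochhammer b (n - k)" for k
  define x where "x k = recip_sum 1 a k" for k
  define y where "y k = recip_sum 1 b (n - k)" for k
  have none: "(\<Sum>k\<le>n. w k) = fact n * C"
    unfolding w_def pochhammer_binomial_sum[symmetric] s total ..
  have left: "(\<Sum>k\<le>n. w k * x k) = fact n * C * D"
    using vandermonde_weighted_left[OF pos, of n] unfolding w_def x_def s total L
    by (simp add: mult_ac)
  have right: "(\<Sum>k\<le>n. w k * y k) = fact n * C * D"
    using vandermonde_weighted_right[OF pos, of n] unfolding w_def y_def s total L
    by (simp add: mult_ac)
  have both: "(\<Sum>k\<le>n. w k * x k * y k) = fact n * C * (D\<^sup>2 - D2)"
    using vandermonde_weighted_both[OF pos, of n] unfolding w_def x_def y_def s total L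
    by (simp add: mult_ac)
  have summand: "fact n * (real ((p + k) choose p) * real ((q + n - k) choose q)
                     * harm (p + k) * harm (q + n - k))
      = w k * x k * y k + harm q * (w k * x k) + harm p * (w k * y k) + harm p * harm q * w k"
    if "k \<le> n" for k
  proof -
    have W: "w k = fact n * (real ((p + k) choose p) * real ((q + n - k) choose q))"
      unfolding w_def params by (rule binomial_pochhammer_product[OF that])
    have "harm (p + k) = x k + harm p" "harm (q + n - k) = y k + harm q"
      using that unfolding x_def y_def params recip_sum_eq_harm by simp_all
    then show ?thesis
      unfolding W by (simp add: algebra_simps)
  qed
  have "fact n * (\<Sum>k=0..n. real ((p + k) choose p) * real ((q + n - k) choose q)
            * harm (p + k) * harm (q + n - k))
      = (\<Sum>k\<le>n. w k * x k * y k + harm q * (w k * x k) + harm p * (w k * y k)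
            + harm p * harm q * w k)"
    unfolding sum_distrib_left atLeast0AtMost by (intro sum.cong summand) auto
  also have "\<dots> = fact n * C * (D\<^sup>2 - D2) + harm q * (fact n * C * D)
                + harm p * (fact n * C * D) + harm p * harm q * (fact n * C)"
    by (simp add: sum.distrib sum_distrib_left[symmetric] none left right both)
  also have "\<dots> = fact n * (C * (- D2 + (harm p + D) * (harm q + D)))"
    by (simp add: algebra_simps power2_eq_square)
  finally have "(\<Sum>k=0..n. real ((p + k) choose p) * real ((q + n - k) choose q)
            * harm (p + k) * harm (q + n - k)) = C * (- D2 + (harm p + D) * (harm q + D))"
    by (simp only: mult_cancel_left fact_nonzero simp_thms)
  moreover have "- D2 = gen_harm 2 (p + q + 1) - gen_harm 2 (p + q + n + 1)"
    "harm r + D = harm r - harm (p + q + 1) + harm (p + q + n + 1)" for r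
    unfolding D_def D2_def by linarith+
  ultimately show ?thesis
    by (simp only: C_def)
qed

end
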